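(* Let $m\ge 2$ be an integer. For every $x\in(0,1)$ the set $\Lambda(x)$ has zero Lebesgue measure, and $\dim_H\Lambda(x)=1$.
   Context: For $\lambda\in(0,1/m]$, $K_\lambda=\left\{\sum_{i=1}^\infty d_i\lambda^i: d_i\in\{0,1,\ldots,m-1\},\ i\ge 1\right\}\subset\mathbb R$, and for $x\in(0,1)$, $\Lambda(x)=\{\lambda\in(0,1/m]: x\in K_\lambda\}$. $\dim_H$ denotes Hausdorff dimension. *)

theory Defs
  imports "HOL-Analysis.Analysis"
begin

(* The value diam(U)^s, with the usual conventions diam({})^s = 0 and diam(U)^0 = 1 for nonempty U.
   The case split is needed because 0 powr 0 = 0 in the library. *)
definition diam_powr :: "real \<Rightarrow> 'a::metric_space set \<Rightarrow> ennreal" where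
  "diam_powr s U =
     (if U = {} then 0 else if s = 0 then 1 else ennreal (diameter U powr s))"

(* Boundedness is required explicitly because diameter is real-valued and hence
   not meaningful on unbounded sets. Finite covers are included by padding with {}. *)
definition hausdorff_premeasure :: "real \<Rightarrow> real \<Rightarrow> 'a::metric_space set \<Rightarrow> ennreal" where
  "hausdorff_premeasure s \<delta> A =
     Inf {(\<Sum>i. diam_powr s (U i)) | U :: nat \<Rightarrow> 'a set.
            A \<subseteq> (\<Union>i. U i) \<and> (\<forall>i. bounded (U i) \<and> diameter (U i) \<le> \<delta>)}"

definition hausdorff_measure :: "real \<Rightarrow> 'a::metric_space set \<Rightarrow> ennreal" where
  "hausdorff_measure s A = (SUP \<delta>\<in>{0<..}. hausdorff_premeasure s \<delta> A)"

definition hausdorff_dim :: "'a::metric_space set \<Rightarrow> ennreal" where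
  "hausdorff_dim A = Inf {ennreal s | s. 0 \<le> s \<and> hausdorff_measure s A = 0}"

(* The parameter lambda is written t. The digit sequence is indexed from 0, so d i is the coefficient of t ^ (i + 1).
   The series converges whenever \<bar>t\<bar> < 1, in particular for 0 < t \<le> 1/m with m \<ge> 2. *)
definition K :: "nat \<Rightarrow> real \<Rightarrow> real set" where
  "K m t = {(\<Sum>i. real (d i) * t ^ Suc i) | d :: nat \<Rightarrow> nat. \<forall>i. d i \<in> {0..m - 1}}"

definition Lambda :: "nat \<Rightarrow> real \<Rightarrow> real set" where
  "Lambda m x = {t \<in> {0<..1 / real m}. x \<in> K m t}"

end

theory Submission
  imports Defs
begin

text \<open>
  Write \<open>F\<^sub>d(t) = d\<^sub>0 t + d\<^sub>1 t^2 + \<dots>\<close> for a digit sequence \<open>d\<close> with entries below \<open>m\<close>; then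
  \<open>t\<close> belongs to \<open>\<Lambda>(x)\<close> iff \<open>0 < t \<le> 1/m\<close> and \<open>F\<^sub>d(t) = x\<close> for some \<open>d\<close>. Everything rests on
  the behaviour of \<open>F\<^sub>d(t)\<close> in its two arguments. In \<open>t\<close> it is Lipschitz, and it grows with slope
  at least \<open>F\<^sub>d(t)\<close> (\<open>expansion_lipschitz\<close>, \<open>expansion_diff_ge\<close>). In \<open>d\<close> it is
  ultrametric-like: if \<open>d\<close> and \<open>e\<close> have the same first \<open>n\<close> digits, the two values differ by at
  most \<open>t^n\<close> (\<open>expansion_agree_le\<close>), and if the next digits differ, then they differ by at least
  \<open>(1 - m t) t^(n+1)\<close> (\<open>expansion_differ_ge\<close>). The gap \<open>1 - m t\<close> closes only at \<open>t = 1/m\<close>.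

  The set is null. Let \<open>b < 1/m\<close>. Two parameters in \<open>\<Lambda>(x) \<inter> (0,b]\<close> whose digit sequences share
  their first \<open>n\<close> digits are at distance at most \<open>b^n/x\<close>: moving the parameter by \<open>\<delta>\<close> raises the
  value by at least \<open>\<delta> x\<close>, while changing the tail of the digits compensates at most \<open>b^n\<close>. There are
  \<open>m^n\<close> words of length \<open>n\<close>, so \<open>\<Lambda>(x) \<inter> (0,b]\<close> has outer measure at most \<open>2 (m b)^n / x\<close>, which
  tends to \<open>0\<close>.

  The dimension is 1. Only the lower bound needs work. Fix \<open>0 \<le> s < 1\<close> and take \<open>b < b' < 1/m\<close> close to \<open>1/m\<close>.
  Every number \<open>y\<close> in a suitable nondegenerate interval just above \<open>x\<close>, with base \<open>m\<close> digits \<open>d\<close>, that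
  is with \<open>F\<^sub>d(1/m) = y\<close>, has a parameter \<open>g(y)\<close> in \<open>[b,b']\<close> with \<open>F\<^sub>d(g(y)) = x\<close>
  (\<open>parameter_exists\<close>); thus \<open>g(y)\<close> lies in \<open>\<Lambda>(x)\<close>. If the digits of \<open>y\<close> and \<open>z\<close> first
  differ at index \<open>n\<close>, then \<open>|y - z| \<le> m^(-n)\<close>, whereas the gap together with the Lipschitz bound
  forces \<open>g(y)\<close> and \<open>g(z)\<close> to be at least a constant times \<open>b^n\<close> apart. Since \<open>1/m \<le> b^s\<close> for \<open>b\<close>
  close to \<open>1/m\<close>, this gives \<open>|y - z| \<le> C |g(y) - g(z)|^s\<close> (\<open>parameter_holder\<close>). A cover
  of \<open>\<Lambda>(x)\<close> therefore pulls back to a cover of an interval of positive length, and the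
  \<open>s\<close>-dimensional measure of \<open>\<Lambda>(x)\<close> cannot vanish (\<open>hausdorff_measure_ne_0_if_holder\<close>).
\<close>

section \<open>Power series with bounded coefficients\<close>

text \<open>
  The coefficients are real rather than digits so that differences of two digit sequences, whose
  entries may be negative, are covered by the same estimates.
\<close>
definition expansion :: "(nat \<Rightarrow> real) \<Rightarrow> real \<Rightarrow> real" where
  "expansion c t = (\<Sum>i. c i * t ^ Suc i)"

lemma summable_expansion:
  fixes c :: "nat \<Rightarrow> real"
  assumes "\<And>i. \<bar>c i\<bar> \<le> M" "0 \<le> t" "t < 1"
  shows "summable (\<lambda>i. c i * t ^ Suc i)"
proof (rule summable_comparison_test'[where g = "\<lambda>i. M * t ^ Suc i" and N = 0])
  show "summable (\<lambda>i. M * t ^ Suc i)"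
    using assms by (intro summable_mult) (simp add: summable_mult summable_geometric)
  show "norm (c n * t ^ Suc n) \<le> M * t ^ Suc n" for n
    using assms(1)[of n] assms(2) by (simp add: abs_mult mult_right_mono)
qed

lemma abs_expansion_tail_le:
  assumes bound: "\<And>i. \<bar>c i\<bar> \<le> M" and t: "0 \<le> t" "t < 1"
    and zero: "\<And>i. i < n \<Longrightarrow> c i = 0"
  shows "\<bar>expansion c t\<bar> \<le> M * t ^ Suc n / (1 - t)"
proof -
  have sm: "summable (\<lambda>i. c i * t ^ Suc i)"
    using summable_expansion bound t by blast
  have "expansion c t = (\<Sum>i. c (i + n) * t ^ Suc (i + n))"
    unfolding expansion_def by (subst suminf_split_initial_segment[OF sm, of n]) (simp add: zero)
  also have "\<bar>\<dots>\<bar> \<le> (\<Sum>i. M * t ^ Suc n * t ^ i)"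
  proof -
    have g: "summable (\<lambda>i. M * t ^ Suc n * t ^ i)"
      using t by (intro summable_mult summable_geometric) simp
    have le: "norm (c (i + n) * t ^ Suc (i + n)) \<le> M * t ^ Suc n * t ^ i" for i
      using mult_right_mono[OF bound[of "i + n"], of "t ^ Suc (i + n)"] t
      by (simp add: abs_mult power_add mult_ac)
    show ?thesis
      using norm_suminf_le[OF le g] by simp
  qed
  also have "\<dots> = M * t ^ Suc n / (1 - t)"
    using t by (subst suminf_mult) (simp_all add: summable_geometric suminf_geometric)
  finally show ?thesis .
qed

lemma expansion_diff:
  assumes "\<And>i. \<bar>c i\<bar> \<le> M" "\<And>i. \<bar>e i\<bar> \<le> N" "0 \<le> t" "t < 1"
  shows "expansion (\<lambda>i. c i - e i) t = expansion c t - expansion e t"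
  unfolding expansion_def
  using suminf_diff[OF summable_expansion[OF assms(1,3,4)] summable_expansion[OF assms(2,3,4)]]
  by (simp add: left_diff_distrib)

text \<open>
  The leading term \<open>c\<^sub>n t^(n+1)\<close> dominates: the tail after it is at most \<open>M t^(n+2) / (1 - t)\<close>,
  and \<open>1 - M t / (1 - t) = (1 - (M + 1) t) / (1 - t)\<close>.
\<close>
lemma expansion_ge_leading:
  assumes bound: "\<And>i. \<bar>c i\<bar> \<le> M" and t: "0 \<le> t" "t * (M + 1) \<le> 1" "t < 1"
    and zero: "\<And>i. i < n \<Longrightarrow> c i = 0" and lead: "1 \<le> c n"
  shows "t ^ Suc n * (1 - (M + 1) * t) \<le> expansion c t"
proof -
  let ?e = "\<lambda>i. if i = n then 1 else 0 :: real"
  define r where "r = (\<lambda>i. if i \<le> n then 0 else c i)"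
  have sm: "summable (\<lambda>i. c i * t ^ Suc i)"
    using summable_expansion bound t by blast
  have M: "0 \<le> M" using bound[of 0] by linarith
  have rb: "\<And>i. \<bar>r i\<bar> \<le> M" using bound M by (auto simp: r_def)
  have cr: "expansion (\<lambda>i. c i - r i) t = expansion c t - expansion r t"
    by (rule expansion_diff[OF bound rb t(1,3)])
  have "expansion (\<lambda>i. c i - r i) t = (\<Sum>i\<in>{n}. (c i - r i) * t ^ Suc i)"
    unfolding expansion_def
    by (rule suminf_finite) (auto simp: r_def zero)
  then have e: "expansion c t = c n * t ^ Suc n + expansion r t"
    using cr by (simp add: r_def)
  have "\<bar>expansion r t\<bar> \<le> M * t ^ Suc (Suc n) / (1 - t)"
    by (rule abs_expansion_tail_le[OF rb t(1,3)]) (auto simp: r_def)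
  moreover have "t ^ Suc n \<le> c n * t ^ Suc n"
    using mult_right_mono[OF lead, of "t ^ Suc n"] t by simp
  ultimately have "t ^ Suc n - M * t ^ Suc (Suc n) / (1 - t) \<le> expansion c t"
    using e by linarith
  moreover have "t ^ Suc n * (1 - (M + 1) * t) \<le> t ^ Suc n - M * t ^ Suc (Suc n) / (1 - t)"
  proof -
    have "(1 - (M + 1) * t) * (1 - t) \<le> (1 - (M + 1) * t) * 1"
      using t by (intro mult_left_mono) (auto simp: mult.commute)
    then have "1 - (M + 1) * t \<le> 1 - M * t / (1 - t)"
      using t by (simp add: field_simps)
    then have "t ^ Suc n * (1 - (M + 1) * t) \<le> t ^ Suc n * (1 - M * t / (1 - t))"
      using t by (intro mult_left_mono) auto
    then show ?thesis by (simp add: algebra_simps)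
  qed
  ultimately show ?thesis by linarith
qed

text \<open>
  Since \<open>v^(i+1) \<ge> v u^i\<close>, each power grows by at least \<open>(v - u) u^i\<close>, hence by at least
  \<open>(v - u) u^(i+1)\<close>. The slope is thus bounded below by the value itself, which stays
  away from \<open>0\<close> at the parameters where the value is a fixed positive \<open>x\<close>.
\<close>
lemma expansion_diff_ge:
  assumes bound: "\<And>i. \<bar>c i\<bar> \<le> M" and nonneg: "\<And>i. 0 \<le> c i"
    and t: "0 \<le> u" "u \<le> v" "v < 1"
  shows "(v - u) * expansion c u \<le> expansion c v - expansion c u"
proof -
  have su: "summable (\<lambda>i. c i * u ^ Suc i)" and sv: "summable (\<lambda>i. c i * v ^ Suc i)"
    using summable_expansion[OF bound] t by auto
  have "(v - u) * (c i * u ^ Suc i) \<le> c i * v ^ Suc i - c i * u ^ Suc i" for i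
  proof -
    have "(v - u) * u ^ Suc i + u ^ Suc i \<le> (v - u) * u ^ i + u ^ Suc i"
      using t by (intro add_right_mono mult_left_mono power_decreasing) auto
    also have "\<dots> = v * u ^ i" by (simp add: algebra_simps)
    also have "\<dots> \<le> v ^ Suc i"
      using t by (simp add: mult_left_mono power_mono)
    finally have "c i * ((v - u) * u ^ Suc i + u ^ Suc i) \<le> c i * v ^ Suc i"
      using nonneg by (intro mult_left_mono)
    then show ?thesis by (simp add: algebra_simps)
  qed
  then have "(\<Sum>i. (v - u) * (c i * u ^ Suc i)) \<le> (\<Sum>i. c i * v ^ Suc i - c i * u ^ Suc i)"
    by (intro suminf_le summable_mult summable_diff su sv)
  then show ?thesis
    unfolding expansion_def suminf_mult[OF su] suminf_diff[OF sv su] .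
qed

text \<open>
  The constant is the termwise derivative bound \<open>M (1 + 2 R + 3 R^2 + \<dots>) = M / (1 - R)^2\<close>.
\<close>
lemma expansion_lipschitz:
  assumes bound: "\<And>i. \<bar>c i\<bar> \<le> M" and R: "0 \<le> R" "R < 1"
    and t: "0 \<le> u" "u \<le> R" "0 \<le> v" "v \<le> R"
  shows "\<bar>expansion c v - expansion c u\<bar> \<le> M / (1 - R)\<^sup>2 * \<bar>v - u\<bar>"
proof -
  have su: "summable (\<lambda>i. c i * u ^ Suc i)" and sv: "summable (\<lambda>i. c i * v ^ Suc i)"
    using summable_expansion[OF bound] t R by auto
  have sR: "summable (\<lambda>i. real (Suc i) * R ^ i)"
    using geometric_deriv_sums[of R] R by (auto simp: sums_iff)
  have le: "norm (c i * v ^ Suc i - c i * u ^ Suc i) \<le> \<bar>v - u\<bar> * M * (real (Suc i) * R ^ i)" for i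
  proof -
    have "\<bar>v ^ Suc i - u ^ Suc i\<bar> = \<bar>v - u\<bar> * \<bar>\<Sum>p<Suc i. v ^ p * u ^ (i - p)\<bar>"
      by (simp only: diff_power_eq_sum abs_mult)
    also have "\<bar>\<Sum>p<Suc i. v ^ p * u ^ (i - p)\<bar> \<le> (\<Sum>p<Suc i. R ^ i)"
    proof (rule order.trans[OF sum_abs sum_mono])
      fix p assume "p \<in> {..<Suc i}"
      then have "R ^ i = R ^ p * R ^ (i - p)" by (simp flip: power_add)
      then show "\<bar>v ^ p * u ^ (i - p)\<bar> \<le> R ^ i"
        using t R by (auto simp: abs_mult intro!: mult_mono power_mono)
    qed
    finally have "\<bar>v ^ Suc i - u ^ Suc i\<bar> \<le> \<bar>v - u\<bar> * (real (Suc i) * R ^ i)"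
      by (simp add: mult_left_mono)
    then have "\<bar>c i\<bar> * \<bar>v ^ Suc i - u ^ Suc i\<bar> \<le> M * (\<bar>v - u\<bar> * (real (Suc i) * R ^ i))"
      using bound[of i] by (intro mult_mono) auto
    then show ?thesis
      unfolding right_diff_distrib[symmetric] real_norm_def abs_mult by (simp only: mult_ac)
  qed
  have "\<bar>\<Sum>i. c i * v ^ Suc i - c i * u ^ Suc i\<bar> \<le> (\<Sum>i. \<bar>v - u\<bar> * M * (real (Suc i) * R ^ i))"
    using norm_suminf_le[OF le summable_mult[OF sR]] by simp
  also have "(\<Sum>i. \<bar>v - u\<bar> * M * (real (Suc i) * R ^ i)) = \<bar>v - u\<bar> * M * (\<Sum>i. real (Suc i) * R ^ i)"
    by (rule suminf_mult[OF sR])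
  also have "(\<Sum>i. real (Suc i) * R ^ i) = 1 / (1 - R)\<^sup>2"
    using geometric_deriv_sums[of R] R by (simp add: sums_iff)
  also have "\<bar>v - u\<bar> * M * (1 / (1 - R)\<^sup>2) = M / (1 - R)\<^sup>2 * \<bar>v - u\<bar>"
    by simp
  also have "(\<Sum>i. c i * v ^ Suc i - c i * u ^ Suc i) = expansion c v - expansion c u"
    unfolding expansion_def by (rule suminf_diff[OF sv su, symmetric])
  finally show ?thesis .
qed

section \<open>Digit sequences\<close>

text \<open>
  The digits are the increments \<open>\<lfloor>m^(i+1) y\<rfloor> - m \<lfloor>m^i y\<rfloor>\<close>, so that the partial sums
  telescope to \<open>\<lfloor>m^n y\<rfloor> / m^n\<close>.
\<close>
lemma base_expansion_exists:
  fixes m :: nat and y :: real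
  assumes m: "m \<ge> 2" and y: "0 \<le> y" "y < 1"
  obtains d :: "nat \<Rightarrow> nat" where "\<And>i. d i < m" "expansion (\<lambda>i. real (d i)) (1 / real m) = y"
proof
  define f where "f = (\<lambda>i. \<lfloor>real m ^ i * y\<rfloor>)"
  define d where "d = (\<lambda>i. nat (f (Suc i) - int m * f i))"
  have lo: "int m * f i \<le> f (Suc i)" for i
  proof -
    have "real_of_int (f i) \<le> real m ^ i * y" unfolding f_def by (rule of_int_floor_le)
    then have "real m * real_of_int (f i) \<le> real m * (real m ^ i * y)"
      by (intro mult_left_mono) auto
    then show ?thesis unfolding f_def le_floor_iff by (simp add: mult_ac)
  qed
  have hi: "f (Suc i) < int m * f i + int m" for i
  proof -
    have "real m ^ i * y < real_of_int (f i) + 1" unfolding f_def by linarith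
    then have "real m * (real m ^ i * y) < real m * (real_of_int (f i) + 1)"
      using m by (intro mult_strict_left_mono) auto
    then show ?thesis unfolding f_def floor_less_iff by (simp add: algebra_simps)
  qed
  show "d i < m" for i
    using hi[of i] lo[of i] m unfolding d_def by linarith
  have step: "real (d i) * (1 / real m) ^ Suc i = f (Suc i) / real m ^ Suc i - f i / real m ^ i" for i
  proof -
    have "real (d i) = real_of_int (f (Suc i) - int m * f i)"
      unfolding d_def using lo[of i] by simp
    then show ?thesis using m by (simp add: field_simps)
  qed
  have lim: "(\<lambda>i. f i / real m ^ i) \<longlonglongrightarrow> y"
  proof (rule tendsto_sandwich)
    show "\<forall>\<^sub>F i in sequentially. y - (1 / real m) ^ i \<le> f i / real m ^ i"
    proof (rule always_eventually, rule allI)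
      fix i
      have "(real m ^ i * y - 1) / real m ^ i \<le> f i / real m ^ i"
        unfolding f_def by (intro divide_right_mono zero_le_power) linarith+
      then show "y - (1 / real m) ^ i \<le> f i / real m ^ i"
        using m by (simp add: diff_divide_distrib power_divide)
    qed
    show "\<forall>\<^sub>F i in sequentially. f i / real m ^ i \<le> y"
      using m unfolding f_def by (intro always_eventually) (simp add: field_simps)
    have "(\<lambda>i. (1 / real m) ^ i) \<longlonglongrightarrow> 0" using m by (intro LIMSEQ_power_zero) simp
    then show "(\<lambda>i. y - (1 / real m) ^ i) \<longlonglongrightarrow> y"
      using tendsto_diff[OF tendsto_const[of y]] by fastforce
  qed auto
  have "f 0 = 0" using y unfolding f_def by (simp add: floor_eq_iff)
  then show "expansion (\<lambda>i. real (d i)) (1 / real m) = y"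
    unfolding expansion_def step using telescope_sums[OF lim] by (simp add: sums_iff)
qed

lemma Lambda_iff:
  assumes "m \<ge> 2"
  shows "t \<in> Lambda m x \<longleftrightarrow>
    0 < t \<and> t \<le> 1 / real m \<and> (\<exists>d. (\<forall>i. d i < m) \<and> expansion (\<lambda>i. real (d i)) t = x)"
proof -
  have "(\<forall>i. d i \<in> {0..m - 1}) \<longleftrightarrow> (\<forall>i. d i < m)" for d :: "nat \<Rightarrow> nat"
    using assms by (intro all_cong1) auto
  then show ?thesis unfolding Lambda_def K_def expansion_def by auto
qed

lemma abs_digit_le: "d < m \<Longrightarrow> \<bar>real d\<bar> \<le> real m - 1"
  by linarith

lemma abs_digit_diff_le: "d < m \<Longrightarrow> e < m \<Longrightarrow> \<bar>real d - real e\<bar> \<le> real m - 1"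
  by linarith

lemma le_inverse_base:
  fixes t :: real
  assumes "m \<ge> 2" "t \<le> 1 / real m"
  shows "real m * t \<le> 1" "t \<le> 1 / 2" "t < 1"
proof -
  show "real m * t \<le> 1" using assms by (simp add: field_simps)
  have "1 / real m \<le> 1 / 2" using assms by (intro divide_left_mono) auto
  then show "t \<le> 1 / 2" "t < 1" using assms by linarith+
qed

text \<open>
  For \<open>t \<le> 1/m\<close> the factor \<open>(m - 1) t / (1 - t)\<close> in the tail estimate is at most \<open>1\<close>.
\<close>
lemma expansion_agree_le:
  assumes m: "m \<ge> 2" and d: "\<And>i. d i < m" and e: "\<And>i. e i < m"
    and agree: "\<And>i. i < n \<Longrightarrow> d i = e i" and t: "0 \<le> t" "t \<le> 1 / real m"
  shows "\<bar>expansion (\<lambda>i. real (d i)) t - expansion (\<lambda>i. real (e i)) t\<bar> \<le> t ^ n"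
proof -
  have mt: "real m * t \<le> 1" and t1: "t < 1"
    using le_inverse_base[OF m t(2)] by simp_all
  have "\<bar>expansion (\<lambda>i. real (d i) - real (e i)) t\<bar> \<le> (real m - 1) * t ^ Suc n / (1 - t)"
    by (rule abs_expansion_tail_le[OF abs_digit_diff_le[OF d e] t(1) t1]) (simp add: agree)
  also have "\<dots> = ((real m - 1) * t / (1 - t)) * t ^ n" by simp
  also have "\<dots> \<le> 1 * t ^ n"
    using t t1 mt by (intro mult_right_mono) (auto simp: field_simps)
  finally show ?thesis
    using expansion_diff[OF abs_digit_le[OF d] abs_digit_le[OF e] t(1) t1] by simp
qed

text \<open>
  This is the strong separation of the Cantor set \<open>K\<^sub>t\<close>: the difference sequence has
  coefficients of modulus at most \<open>m - 1\<close>, and the first nonzero one, an integer, has modulus at least \<open>1\<close>.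
\<close>
lemma expansion_differ_ge:
  assumes m: "m \<ge> 2" and d: "\<And>i. d i < m" and e: "\<And>i. e i < m"
    and agree: "\<And>i. i < n \<Longrightarrow> d i = e i" and differ: "d n \<noteq> e n"
    and t: "0 \<le> t" "t \<le> 1 / real m"
  shows "t ^ Suc n * (1 - real m * t) \<le> \<bar>expansion (\<lambda>i. real (d i)) t - expansion (\<lambda>i. real (e i)) t\<bar>"
proof -
  have mt: "t * real m \<le> 1" and t1: "t < 1"
    using le_inverse_base[OF m t(2)] by (simp_all add: mult.commute)
  have ordered: "t ^ Suc n * (1 - real m * t) \<le> expansion (\<lambda>i. real (d i)) t - expansion (\<lambda>i. real (e i)) t"
    if d: "\<And>i. d i < m" and e: "\<And>i. e i < m"
      and agree: "\<And>i. i < n \<Longrightarrow> d i = e i" and less: "e n < d n" for d e :: "nat \<Rightarrow> nat"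
  proof -
    have "t ^ Suc n * (1 - ((real m - 1) + 1) * t) \<le> expansion (\<lambda>i. real (d i) - real (e i)) t"
      by (rule expansion_ge_leading[OF abs_digit_diff_le[OF d e] t(1)])
        (use agree less mt t1 in auto)
    also have "\<dots> = expansion (\<lambda>i. real (d i)) t - expansion (\<lambda>i. real (e i)) t"
      by (rule expansion_diff[OF abs_digit_le[OF d] abs_digit_le[OF e] t(1) t1])
    finally show ?thesis by simp
  qed
  show ?thesis
  proof (cases "e n < d n")
    case True
    then show ?thesis using ordered[OF d e agree] by force
  next
    case False
    then show ?thesis using ordered[OF e d agree[symmetric]] differ by force
  qed
qed

lemma continuous_on_expansion:
  assumes "\<And>i. \<bar>c i\<bar> \<le> M" "0 \<le> u" "v < 1"
  shows "continuous_on {u..v} (expansion c)"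
proof (cases "u \<le> v")
  case True
  have "(M / (1 - v)\<^sup>2)-lipschitz_on {u..v} (expansion c)"
  proof (rule lipschitz_onI)
    show "dist (expansion c s) (expansion c t) \<le> M / (1 - v)\<^sup>2 * dist s t"
      if "s \<in> {u..v}" "t \<in> {u..v}" for s t
      using expansion_lipschitz[OF assms(1), of v t s] that assms(2,3) True
      by (simp add: dist_real_def)
    show "0 \<le> M / (1 - v)\<^sup>2"
      using assms(1)[of 0] by simp
  qed
  then show ?thesis by (rule lipschitz_on_continuous_on)
qed simp

section \<open>The null set property\<close>

text \<open>
  Keep the digits \<open>d\<close> and move from \<open>u\<close> to \<open>v\<close>: the value rises from \<open>x\<close> by at least
  \<open>(v - u) x\<close>. Replacing \<open>d\<close> by \<open>e\<close> at \<open>v\<close> must bring it back to \<open>x\<close>, but changes it by at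
  most \<open>v^n\<close>.
\<close>
lemma Lambda_parameters_close:
  assumes m: "m \<ge> 2" and d: "\<And>i. d i < m" and e: "\<And>i. e i < m"
    and agree: "\<And>i. i < n \<Longrightarrow> d i = e i"
    and uv: "0 < u" "u \<le> v" "v \<le> 1 / real m"
    and x: "expansion (\<lambda>i. real (d i)) u = x" "expansion (\<lambda>i. real (e i)) v = x"
  shows "(v - u) * x \<le> v ^ n"
proof -
  have "v < 1" using le_inverse_base[OF m uv(3)] by simp
  then have "(v - u) * x \<le> expansion (\<lambda>i. real (d i)) v - x"
    using expansion_diff_ge[where c = "\<lambda>i. real (d i)" and u = u and v = v, OF abs_digit_le[OF d]] uv x
    by simp
  also have "\<dots> \<le> v ^ n"
    using expansion_agree_le[where d = d and e = e and n = n and t = v, OF m d e agree] uv x by simp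
  finally show ?thesis .
qed

text \<open>
  Sort the parameters by the first \<open>n\<close> digits of a digit sequence representing \<open>x\<close>. Each of the \<open>m^n\<close>
  classes fits into an interval of radius \<open>b^n/x\<close>, and \<open>m b < 1\<close>.
\<close>
lemma negligible_Lambda_below:
  assumes m: "m \<ge> 2" and x: "0 < x" and b: "0 \<le> b" "b < 1 / real m"
  shows "negligible (Lambda m x \<inter> {..b})"
proof -
  define S where "S = Lambda m x \<inter> {..b}"
  have S: "0 < t \<and> t \<le> b \<and> t \<le> 1 / real m" if "t \<in> S" for t
    using that m by (auto simp: S_def Lambda_iff)
  have "\<forall>t\<in>S. \<exists>d. (\<forall>i. d i < m) \<and> expansion (\<lambda>i. real (d i)) t = x"
    using m by (auto simp: S_def Lambda_iff)
  then obtain c where c: "\<And>t i. t \<in> S \<Longrightarrow> c t i < m"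
    and cx: "\<And>t. t \<in> S \<Longrightarrow> expansion (\<lambda>i. real (c t i)) t = x"
    by metis
  have "\<exists>T. S \<subseteq> T \<and> T \<in> lmeasurable \<and> measure lebesgue T < \<epsilon>" if "0 < \<epsilon>" for \<epsilon>
  proof -
    have "(\<lambda>n. (real m * b) ^ n * (2 / x)) \<longlonglongrightarrow> 0 * (2 / x)"
      using b m by (intro tendsto_mult_right LIMSEQ_power_zero) (auto simp: field_simps)
    then have "\<forall>\<^sub>F n in sequentially. (real m * b) ^ n * (2 / x) < \<epsilon>"
      using \<open>0 < \<epsilon>\<close> by (intro order_tendstoD) auto
    then obtain n where n: "(real m * b) ^ n * (2 / x) < \<epsilon>"
      using eventually_happens trivial_limit_sequentially by blast
    define r where "r = b ^ n / x"
    define W where "W = PiE {..<n} (\<lambda>_. {..<m})"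
    \<comment> \<open>A centre for each class; for a word whose class is empty the choice is arbitrary and harmless.\<close>
    define p where "p = (\<lambda>w. SOME t. t \<in> S \<and> restrict (c t) {..<n} = w)"
    let ?T = "\<Union>w\<in>W. {p w - r..p w + r}"
    have fin: "finite W" and card: "card W = m ^ n"
      unfolding W_def by (auto simp: card_PiE intro: finite_PiE)
    have "S \<subseteq> ?T"
    proof
      fix t assume t: "t \<in> S"
      define w where "w = restrict (c t) {..<n}"
      have w: "w \<in> W" unfolding w_def W_def using c[OF t] by auto
      have "\<exists>t. t \<in> S \<and> restrict (c t) {..<n} = w" using t w_def by blast
      then have p: "p w \<in> S" "restrict (c (p w)) {..<n} = w"
        unfolding p_def by (metis (mono_tags, lifting) someI_ex)+
      have agree: "c t i = c (p w) i" if "i < n" for i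
        using p(2) that unfolding w_def by (metis lessThan_iff restrict_apply')
      have close: "(v - u) * x \<le> b ^ n"
        if "u \<in> S" "v \<in> S" "u \<le> v" "\<And>i. i < n \<Longrightarrow> c u i = c v i" for u v
      proof -
        have "(v - u) * x \<le> v ^ n"
          by (rule Lambda_parameters_close[where d = "c u" and e = "c v", OF m c[OF that(1)] c[OF that(2)] that(4)])
            (use that(3) S[OF that(1)] S[OF that(2)] cx[OF that(1)] cx[OF that(2)] in auto)
        also have "\<dots> \<le> b ^ n" using S[OF that(2)] by (intro power_mono) auto
        finally show ?thesis .
      qed
      have "\<bar>t - p w\<bar> * x \<le> b ^ n"
      proof (cases "t \<le> p w")
        case True
        then show ?thesis using close[OF t p(1) True agree] by simp
      next
        case False
        then show ?thesis using close[OF p(1) t _ agree[symmetric]] by simp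
      qed
      then have "\<bar>t - p w\<bar> \<le> r" using x by (simp add: r_def field_simps)
      then have "t \<in> {p w - r..p w + r}" unfolding atLeastAtMost_iff by linarith
      then show "t \<in> ?T" using w by blast
    qed
    moreover have "?T \<in> lmeasurable"
      using fin by (intro fmeasurable.finite_UN) auto
    moreover have "measure lebesgue ?T < \<epsilon>"
    proof -
      have "0 \<le> r" using b x by (simp add: r_def)
      have "measure lebesgue ?T \<le> (\<Sum>w\<in>W. measure lebesgue {p w - r..p w + r})"
        by (intro measure_UNION_le fin) auto
      also have "\<dots> = (real m * b) ^ n * (2 / x)"
        using \<open>0 \<le> r\<close> by (simp add: card r_def power_mult_distrib)
      finally show ?thesis using n by linarith
    qed
    ultimately show ?thesis by blast
  qed
  then show ?thesis unfolding S_def[symmetric] by (subst negligible_outer) blast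
qed

text \<open>
  The covering bound degenerates at \<open>1/m\<close>, so the half-open interval below \<open>1/m\<close> is exhausted by
  countably many closed ones.
\<close>
lemma null_sets_Lambda:
  assumes m: "m \<ge> 2" and x: "0 < x"
  shows "Lambda m x \<in> null_sets lebesgue"
proof -
  define b where "b = (\<lambda>k. (1 - 1 / real (Suc k)) / real m)"
  have "negligible ({1 / real m} \<union> (\<Union>k. Lambda m x \<inter> {..b k}))"
  proof (intro negligible_Un negligible_Union_nat negligible_Lambda_below m x)
    show "0 \<le> b k" "b k < 1 / real m" for k
      using m by (auto simp: b_def intro!: divide_strict_right_mono)
  qed simp
  moreover have "Lambda m x \<subseteq> {1 / real m} \<union> (\<Union>k. Lambda m x \<inter> {..b k})"
  proof
    fix t assume t: "t \<in> Lambda m x"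
    show "t \<in> {1 / real m} \<union> (\<Union>k. Lambda m x \<inter> {..b k})"
    proof (cases "t = 1 / real m")
      case False
      then have "t < 1 / real m" using t m by (auto simp: Lambda_iff)
      then have "0 < 1 - real m * t" using m by (simp add: field_simps)
      then obtain k where "1 / real (Suc k) < 1 - real m * t" by (rule nat_approx_posE)
      then have "t * real m \<le> 1 - 1 / real (Suc k)" by (subst mult.commute) linarith
      then have "t \<le> b k" using m unfolding b_def by (subst pos_le_divide_eq) auto
      then show ?thesis using t by blast
    qed simp
  qed
  ultimately have "negligible (Lambda m x)" by (rule negligible_subset)
  then show ?thesis by (simp add: negligible_iff_null_sets)
qed

section \<open>Two estimates of Hausdorff measures\<close>

text \<open>
  The grid of \<open>n\<close> intervals of length \<open>1/n\<close> has \<open>s\<close>-sum \<open>n^(1-s)\<close>, which tends to \<open>0\<close>.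
\<close>
lemma hausdorff_measure_unit_interval_eq_0:
  fixes A :: "real set"
  assumes A: "A \<subseteq> {0..1}" and s: "1 < s"
  shows "hausdorff_measure s A = 0"
proof -
  have "hausdorff_premeasure s \<delta> A \<le> 0" if \<delta>: "0 < \<delta>" for \<delta>
  proof (rule tendsto_lowerbound)
    have "(\<lambda>n. real n powr (1 - s)) \<longlonglongrightarrow> 0"
      using s by (intro tendsto_neg_powr filterlim_real_sequentially) simp
    then show "(\<lambda>n. ennreal (real n powr (1 - s))) \<longlonglongrightarrow> 0"
      using tendsto_ennrealI by fastforce
    have "\<forall>\<^sub>F n in sequentially. 1 / \<delta> < real n"
      by (intro filterlim_at_top_dense[THEN iffD1, rule_format] filterlim_real_sequentially)
    then show "\<forall>\<^sub>F n in sequentially. hausdorff_premeasure s \<delta> A \<le> ennreal (real n powr (1 - s))"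
    proof (rule eventually_mono)
      fix n assume n: "1 / \<delta> < real n"
      then have n0: "0 < n" using \<delta> by (metis divide_pos_pos less_trans of_nat_0_less_iff zero_less_one)
      have n\<delta>: "1 / real n \<le> \<delta>" using n n0 \<delta> by (simp add: field_simps)
      define U where "U = (\<lambda>i. if i < n then {real i / real n..(real i + 1) / real n} else {})"
      have len: "(real i + 1) / real n - real i / real n = 1 / real n" for i
        by (simp add: add_divide_distrib)
      have le: "real i / real n \<le> (real i + 1) / real n" for i
        by (intro divide_right_mono) auto
      have diam: "diameter (U i) = (if i < n then 1 / real n else 0)" for i
        using len[of i] le[of i] by (simp add: U_def)
      have "(\<Sum>i. diam_powr s (U i)) = (\<Sum>i<n. diam_powr s (U i))"
        by (rule suminf_finite) (auto simp: U_def diam_powr_def)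
      also have "\<dots> = (\<Sum>i<n. ennreal ((1 / real n) powr s))"
      proof (intro sum.cong refl)
      show "diam_powr s (U i) = ennreal ((1 / real n) powr s)" if "i \<in> {..<n}" for i
      proof -
        have "U i \<noteq> {}" using le[of i] that by (simp add: U_def not_less)
        then show ?thesis using s diam[of i] that by (simp add: diam_powr_def)
      qed
    qed
      also have "\<dots> = ennreal (real n * (1 / real n) powr s)"
        by (simp add: ennreal_mult ennreal_of_nat_eq_real_of_nat)
      also have "real n * (1 / real n) powr s = real n powr (1 - s)"
        using n0 by (simp add: powr_diff powr_divide)
      finally have sum: "(\<Sum>i. diam_powr s (U i)) = ennreal (real n powr (1 - s))" .
      have "A \<subseteq> (\<Union>i. U i)"
      proof
        fix a assume "a \<in> A"
        then have a: "0 \<le> a" "a \<le> 1" using A by auto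
        show "a \<in> (\<Union>i. U i)"
          \<comment> \<open>The right end point is the only one whose floor index \<open>n\<close> is out of range.\<close>
        proof (cases "a = 1")
          case True
          then have "a \<in> U (n - 1)" using n0 by (simp add: U_def)
          then show ?thesis by blast
        next
          case False
          define i where "i = nat \<lfloor>a * real n\<rfloor>"
          have i: "real i \<le> a * real n" "a * real n < real i + 1"
            using a unfolding i_def by auto
          have "a * real n < real n" using a False n0 by simp
          then have "i < n" using i by linarith
          then have "a \<in> U i" using i n0 by (simp add: U_def field_simps)
          then show ?thesis by blast
        qed
      qed
      moreover have "bounded (U i) \<and> diameter (U i) \<le> \<delta>" for i
        using n\<delta> \<delta> by (simp only: diam) (simp add: U_def)
      ultimately show "hausdorff_premeasure s \<delta> A \<le> ennreal (real n powr (1 - s))"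
        unfolding hausdorff_premeasure_def sum[symmetric] by (intro Inf_lower) blast
    qed
  qed simp
  then show ?thesis
    unfolding hausdorff_measure_def by (auto intro!: SUP_eqI)
qed

text \<open>
  The hypothesis says that \<open>g\<close> has an \<open>s\<close>-Hoelder inverse on its image. The preimage under \<open>g\<close> of
  a set of diameter \<open>\<delta>\<close> lies in an interval of length \<open>2 C \<delta>^s\<close>, so countable subadditivity of
  Lebesgue measure bounds every covering sum from below by \<open>(q - p) / (2 C)\<close>. The convention
  \<open>0 powr 0 = 0\<close> makes the hypothesis force injectivity of \<open>g\<close> for \<open>s = 0\<close> as well.
\<close>
lemma hausdorff_measure_ne_0_if_holder:
  fixes g :: "real \<Rightarrow> 'a::metric_space"
  assumes pq: "p < q" and C: "0 < C" and s: "0 \<le> s"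
    and gA: "\<And>y. y \<in> {p..q} \<Longrightarrow> g y \<in> A"
    and holder: "\<And>y z. y \<in> {p..q} \<Longrightarrow> z \<in> {p..q} \<Longrightarrow> \<bar>y - z\<bar> \<le> C * dist (g y) (g z) powr s"
  shows "hausdorff_measure s A \<noteq> 0"
proof -
  have lower: "ennreal ((q - p) / (2 * C)) \<le> (\<Sum>i. diam_powr s (U i))"
    if U: "A \<subseteq> (\<Union>i. U i)" and bd: "\<And>i. bounded (U i)" for U :: "nat \<Rightarrow> 'a set"
  proof -
    have "\<exists>T \<in> sets lborel. {y \<in> {p..q}. g y \<in> U i} \<subseteq> T \<and>
        emeasure lborel T \<le> ennreal (2 * C) * diam_powr s (U i)" for i
    proof (cases "{y \<in> {p..q}. g y \<in> U i} = {}")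
      case False
      then obtain z where z: "z \<in> {p..q}" "g z \<in> U i" by blast
      define D where "D = diameter (U i) powr s"
      have D: "0 \<le> D" by (simp add: D_def)
      have "y \<in> {z - C * D..z + C * D}" if y: "y \<in> {p..q}" "g y \<in> U i" for y
      proof -
        have "\<bar>y - z\<bar> \<le> C * dist (g y) (g z) powr s" using holder y z by blast
        also have "\<dots> \<le> C * D"
          unfolding D_def using C s y z bd
          by (intro mult_left_mono powr_mono2 diameter_bounded_bound) auto
        finally show ?thesis unfolding atLeastAtMost_iff by linarith
      qed
      moreover have "emeasure lborel {z - C * D..z + C * D} = ennreal (2 * C) * ennreal D"
        using C D by (simp flip: ennreal_mult)
      moreover have "ennreal D \<le> diam_powr s (U i)"
        using z by (auto simp: diam_powr_def D_def)
      ultimately show ?thesis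
        by (intro bexI[of _ "{z - C * D..z + C * D}"]) (auto intro: mult_left_mono)
    qed (auto intro!: bexI[of _ "{}"])
    then obtain T where T: "\<And>i. T i \<in> sets lborel" "\<And>i. {y \<in> {p..q}. g y \<in> U i} \<subseteq> T i"
      "\<And>i. emeasure lborel (T i) \<le> ennreal (2 * C) * diam_powr s (U i)"
      by metis
    have "{p..q} \<subseteq> (\<Union>i. T i)"
      using gA U T(2) by blast
    then have "ennreal (q - p) \<le> emeasure lborel (\<Union>i. T i)"
      using pq T(1) emeasure_mono[of "{p..q}" "\<Union>i. T i" lborel] by auto
    also have "\<dots> \<le> (\<Sum>i. emeasure lborel (T i))"
      using T(1) by (intro emeasure_subadditive_countably) auto
    also have "\<dots> \<le> (\<Sum>i. ennreal (2 * C) * diam_powr s (U i))"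
      by (intro suminf_le T(3)) auto
    also have "\<dots> = ennreal (2 * C) * (\<Sum>i. diam_powr s (U i))" by simp
    finally have "ennreal (1 / (2 * C)) * ennreal (q - p)
        \<le> ennreal (1 / (2 * C)) * (ennreal (2 * C) * (\<Sum>i. diam_powr s (U i)))"
      by (intro mult_left_mono) auto
    also have "\<dots> = (\<Sum>i. diam_powr s (U i))"
      using C by (simp flip: mult.assoc ennreal_mult)
    finally show ?thesis using C pq by (simp flip: ennreal_mult)
  qed
  have "0 < ennreal ((q - p) / (2 * C))" using pq C by simp
  also have "\<dots> \<le> hausdorff_premeasure s 1 A"
    unfolding hausdorff_premeasure_def using lower by (intro Inf_greatest) blast
  also have "\<dots> \<le> hausdorff_measure s A"
    unfolding hausdorff_measure_def by (intro SUP_upper) simp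
  finally show ?thesis by simp
qed

section \<open>A large subset near the right end\<close>

text \<open>
  Among all digit sequences the constant one \<open>m - 1\<close> loses the most when the parameter drops from
  \<open>1/m\<close> to \<open>t\<close>, since the complementary digits \<open>m - 1 - d\<^sub>i\<close> also have an increasing expansion.
\<close>
lemma expansion_geometric_gap:
  assumes m: "m \<ge> 2" and d: "\<And>i. d i < m" and t: "0 \<le> t" "t \<le> 1 / real m"
  shows "expansion (\<lambda>i. real (d i)) (1 / real m) - expansion (\<lambda>i. real (d i)) t
    \<le> 1 - (real m - 1) * t / (1 - t)"
proof -
  define e where "e = (\<lambda>i. (real m - 1) - real (d i))"
  have e: "\<bar>e i\<bar> \<le> real m - 1" "0 \<le> e i" for i
    using d[of i] unfolding e_def by linarith+
  have const: "expansion (\<lambda>_. real m - 1) u = (real m - 1) * u / (1 - u)" if "0 \<le> u" "u < 1" for u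
  proof -
    have "(\<lambda>i. (real m - 1) * u * u ^ i) sums ((real m - 1) * u * (1 / (1 - u)))"
      using that by (intro sums_mult geometric_sums) simp
    then show ?thesis unfolding expansion_def by (simp add: sums_iff mult.assoc)
  qed
  have ee: "expansion e u = (real m - 1) * u / (1 - u) - expansion (\<lambda>i. real (d i)) u"
    if "0 \<le> u" "u \<le> 1 / real m" for u
    unfolding e_def
    using expansion_diff[where c = "\<lambda>_. real m - 1" and M = "real m - 1" and e = "\<lambda>i. real (d i)" and t = u,
        OF _ abs_digit_le[OF d]] const[of u] that le_inverse_base[OF m that(2)] m by simp
  have "0 \<le> expansion e t"
    unfolding expansion_def using e t le_inverse_base[OF m t(2)]
    by (intro suminf_nonneg summable_expansion[OF e(1)]) auto
  then have "0 \<le> (1 / real m - t) * expansion e t" using t by simp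
  also have "\<dots> \<le> expansion e (1 / real m) - expansion e t"
    using le_inverse_base(3)[OF m, of "1 / real m"] t by (intro expansion_diff_ge[OF e]) auto
  finally have "expansion e t \<le> expansion e (1 / real m)" by simp
  moreover have "(real m - 1) * (1 / real m) / (1 - 1 / real m) = 1"
    using m by (simp add: field_simps)
  ultimately show ?thesis
    using ee[OF t] ee[of "1 / real m"] by (simp only: order.refl) auto
qed

text \<open>
  An expansion without constant term and with nonnegative coefficients, divided by its argument,
  is increasing.
\<close>
lemma expansion_scale_le:
  assumes c: "\<And>i. \<bar>c i\<bar> \<le> M" "\<And>i. 0 \<le> c i" and uv: "0 \<le> u" "u \<le> v" "v < 1"
  shows "v * expansion c u \<le> u * expansion c v"
proof -
  have su: "summable (\<lambda>i. c i * u ^ Suc i)" and sv: "summable (\<lambda>i. c i * v ^ Suc i)"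
    using summable_expansion[OF c(1)] uv by auto
  have "v * (c i * u ^ Suc i) \<le> u * (c i * v ^ Suc i)" for i
  proof -
    have "(c i * v * u) * u ^ i \<le> (c i * v * u) * v ^ i"
      using c uv by (intro mult_left_mono power_mono) auto
    then show ?thesis by (simp add: mult_ac)
  qed
  then have "(\<Sum>i. v * (c i * u ^ Suc i)) \<le> (\<Sum>i. u * (c i * v ^ Suc i))"
    by (intro suminf_le summable_mult su sv)
  then show ?thesis unfolding expansion_def suminf_mult[OF su] suminf_mult[OF sv] .
qed

text \<open>
  The two bounds on \<open>y\<close> are what the intermediate value theorem needs on \<open>[b,b']\<close>. Passing from
  \<open>1/m\<close> to \<open>b'\<close> loses at most \<open>1 - (m - 1) b' / (1 - b')\<close>, so the value at \<open>b'\<close> is still at least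
  \<open>x\<close>; the value at \<open>b\<close> is at most \<open>m b y\<close>, hence at most \<open>x\<close>.
\<close>
lemma parameter_exists:
  assumes m: "m \<ge> 2" and d: "\<And>i. d i < m" and x: "0 < x"
    and bb: "0 < b" "b \<le> b'" "b' < 1 / real m"
    and y: "expansion (\<lambda>i. real (d i)) (1 / real m) = y"
    and lo: "x + (1 - (real m - 1) * b' / (1 - b')) \<le> y" and hi: "y \<le> x / (b * real m)"
  obtains t where "t \<in> {b..b'}" "expansion (\<lambda>i. real (d i)) t = x"
proof -
  let ?F = "expansion (\<lambda>i. real (d i))"
  have m1: "1 / real m < 1" using le_inverse_base(3)[OF m] by blast
  have "1 / real m * ?F b \<le> b * y"
    using expansion_scale_le[where c = "\<lambda>i. real (d i)" and u = b and v = "1 / real m", OF abs_digit_le[OF d]]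
      bb m1 y by simp
  also have "\<dots> \<le> 1 / real m * x"
    using hi bb m by (simp add: field_simps)
  finally have "?F b \<le> x" using m by (simp add: divide_right_mono_neg divide_le_cancel)
  moreover have "x \<le> ?F b'"
    using expansion_geometric_gap[where d = d, OF m d, of b'] bb lo y by simp
  moreover have "continuous_on {b..b'} ?F"
    using bb m1 by (intro continuous_on_expansion[OF abs_digit_le[OF d]]) auto
  ultimately obtain t where "b \<le> t" "t \<le> b'" "?F t = x"
    using IVT'[of ?F b x b'] bb by blast
  then show ?thesis using that by simp
qed

text \<open>
  Let the digits first differ at index \<open>n\<close>. At the common parameter \<open>u\<close> the two expansions differ by
  at least \<open>b^(n+1) (1 - m b')\<close>, while the one with digits \<open>e\<close> reaches the value \<open>x\<close> at \<open>v\<close>; by the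
  Lipschitz bound this takes a step \<open>v - u\<close> of order at least \<open>b^n\<close>. The factor \<open>4\<close> is the Lipschitz
  factor \<open>1 / (1 - R)^2\<close> at \<open>R = 1/2\<close>, and all parameters are at most \<open>1/m \<le> 1/2\<close>.
\<close>
lemma parameter_holder:
  assumes m: "m \<ge> 2" and d: "\<And>i. d i < m" and e: "\<And>i. e i < m"
    and bb: "0 < b" "b' < 1 / real m" and s: "0 \<le> s" "1 / real m \<le> b powr s"
    and uv: "u \<in> {b..b'}" "v \<in> {b..b'}"
    and x: "expansion (\<lambda>i. real (d i)) u = x" "expansion (\<lambda>i. real (e i)) v = x"
  shows "\<bar>expansion (\<lambda>i. real (d i)) (1 / real m) - expansion (\<lambda>i. real (e i)) (1 / real m)\<bar>
    \<le> (4 * (real m - 1) / (b * (1 - real m * b'))) powr s * dist u v powr s"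
proof (cases "d = e")
  case False
  define n where "n = (LEAST i. d i \<noteq> e i)"
  have differ: "d n \<noteq> e n"
    using False LeastI_ex[of "\<lambda>i. d i \<noteq> e i"] unfolding n_def by blast
  have agree: "d i = e i" if "i < n" for i
    using not_less_Least[of i "\<lambda>i. d i \<noteq> e i"] that n_def by blast
  define \<kappa> where "\<kappa> = b * (1 - real m * b')"
  have \<kappa>: "0 < \<kappa>" using bb m by (simp add: \<kappa>_def field_simps)
  have half: "u \<le> 1 / 2" "v \<le> 1 / 2"
    using le_inverse_base(2)[OF m] uv bb by auto
  have "b ^ n * \<kappa> = b ^ Suc n * (1 - real m * b')" by (simp add: \<kappa>_def)
  also have "\<dots> \<le> u ^ Suc n * (1 - real m * u)"
  proof (rule mult_mono)
    show "b ^ Suc n \<le> u ^ Suc n" using bb uv by (intro power_mono) auto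
    show "1 - real m * b' \<le> 1 - real m * u" using uv by (simp add: mult_left_mono)
    show "0 \<le> 1 - real m * b'" using bb m by (simp add: field_simps)
    show "0 \<le> u ^ Suc n" using bb uv by (intro zero_le_power) auto
  qed
  also have "\<dots> \<le> \<bar>x - expansion (\<lambda>i. real (e i)) u\<bar>"
    using expansion_differ_ge[where d = d and e = e and t = u, OF m d e agree differ] uv bb x by simp
  also have "\<dots> \<le> (real m - 1) / (1 - 1 / 2)\<^sup>2 * \<bar>v - u\<bar>"
    using expansion_lipschitz[where c = "\<lambda>i. real (e i)" and R = "1 / 2" and u = u and v = v, OF abs_digit_le[OF e]]
      uv bb half x by simp
  also have "\<dots> = 4 * (real m - 1) * dist u v"
    by (simp add: power2_eq_square dist_real_def abs_minus_commute)
  finally have "b ^ n \<le> 4 * (real m - 1) / \<kappa> * dist u v"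
    using \<kappa> by (simp add: field_simps)
  then have powr: "(b ^ n) powr s \<le> (4 * (real m - 1) / \<kappa> * dist u v) powr s"
    using bb s by (intro powr_mono2) auto
  have "\<bar>expansion (\<lambda>i. real (d i)) (1 / real m) - expansion (\<lambda>i. real (e i)) (1 / real m)\<bar>
      \<le> (1 / real m) ^ n"
    by (rule expansion_agree_le[OF m d e agree]) auto
  also have "\<dots> \<le> (b powr s) ^ n" using s by (intro power_mono) auto
  also have "\<dots> = (b ^ n) powr s"
    using bb by (simp add: powr_realpow[symmetric] powr_powr mult.commute)
  also note powr
  also have "(4 * (real m - 1) / \<kappa> * dist u v) powr s = (4 * (real m - 1) / \<kappa>) powr s * dist u v powr s"
    by (rule powr_mult)
  finally show ?thesis unfolding \<kappa>_def .
qed simp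

text \<open>
  The parameters are chosen in the order \<open>b\<close>, \<open>b'\<close>. First \<open>b < 1/m\<close> is taken so close to \<open>1/m\<close> that
  \<open>1/m < b^s\<close> (possible as \<open>s < 1\<close>) and that \<open>x / (m b) < 1\<close>. As \<open>x / (m b) > x\<close> and the loss
  \<open>1 - (m - 1) b' / (1 - b')\<close> vanishes at \<open>b' = 1/m\<close>, a \<open>b'\<close> between \<open>b\<close> and \<open>1/m\<close> then leaves a
  nondegenerate interval \<open>[p,q]\<close> of admissible \<open>y\<close>.
\<close>
lemma hausdorff_measure_Lambda_ne_0:
  assumes m: "m \<ge> 2" and x: "0 < x" "x < 1" and s: "0 \<le> s" "s < 1"
  shows "hausdorff_measure s (Lambda m x) \<noteq> 0"
proof -
  define a where "a = 1 / real m"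
  have a: "0 < a" "a < 1" using m by (auto simp: a_def)
  have "\<forall>\<^sub>F b in at_left a. a < b powr s"
  proof (rule order_tendstoD)
    show "((\<lambda>b. b powr s) \<longlongrightarrow> a powr s) (at_left a)"
      using a by (intro tendsto_intros) auto
    show "a < a powr s" using powr_less_mono'[of a s 1] a s by simp
  qed
  moreover have "\<forall>\<^sub>F b in at_left a. a * x < b"
    using a x by (intro order_tendstoD(1)[OF tendsto_ident_at]) auto
  moreover have "\<forall>\<^sub>F b in at_left a. b < a" by (simp add: eventually_at_left_field) (meson lt_ex)
  ultimately have "\<forall>\<^sub>F b in at_left a. a < b powr s \<and> a * x < b \<and> b < a"
    by eventually_elim simp
  then obtain b where b: "a < b powr s" "a * x < b" "b < a"
    using eventually_happens trivial_limit_at_left_real by blast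
  have b0: "0 < b" using b(2) a x by (meson less_trans mult_pos_pos)
  have bm: "b * real m < 1" "x < b * real m" using b(2,3) m by (auto simp: a_def field_simps)
  have "\<forall>\<^sub>F b' in at_left a. x + (1 - (real m - 1) * b' / (1 - b')) < x / (b * real m)"
  proof (rule order_tendstoD)
    have "((\<lambda>b'. x + (1 - (real m - 1) * b' / (1 - b'))) \<longlongrightarrow> x + (1 - (real m - 1) * a / (1 - a))) (at_left a)"
      using a by (intro tendsto_intros) auto
    also have "x + (1 - (real m - 1) * a / (1 - a)) = x" using m by (simp add: a_def field_simps)
    finally show "((\<lambda>b'. x + (1 - (real m - 1) * b' / (1 - b'))) \<longlongrightarrow> x) (at_left a)" .
    show "x < x / (b * real m)"
      using x bm b0 m by (simp add: field_simps)
  qed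
  moreover have "\<forall>\<^sub>F b' in at_left a. b < b'"
    using b by (intro order_tendstoD(1)[OF tendsto_ident_at])
  moreover have "\<forall>\<^sub>F b' in at_left a. b' < a" by (simp add: eventually_at_left_field) (meson lt_ex)
  ultimately have "\<forall>\<^sub>F b' in at_left a.
      x + (1 - (real m - 1) * b' / (1 - b')) < x / (b * real m) \<and> b < b' \<and> b' < a"
    by eventually_elim simp
  then obtain b' where b': "x + (1 - (real m - 1) * b' / (1 - b')) < x / (b * real m)" "b < b'" "b' < a"
    using eventually_happens trivial_limit_at_left_real by blast
  define p q where "p = x + (1 - (real m - 1) * b' / (1 - b'))" and "q = x / (b * real m)"
  have "real m * b' \<le> 1" "b' < 1"
    using le_inverse_base[OF m, of b'] b' by (auto simp: a_def)
  then have "(real m - 1) * b' / (1 - b') \<le> 1"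
    by (subst pos_divide_le_eq) (auto simp: algebra_simps)
  then have p0: "0 \<le> p" using x by (simp add: p_def)
  have q1: "q < 1" using bm b0 m by (simp add: q_def field_simps)
  have "\<exists>d t. (\<forall>i. d i < m) \<and> expansion (\<lambda>i. real (d i)) (1 / real m) = y
      \<and> t \<in> {b..b'} \<and> expansion (\<lambda>i. real (d i)) t = x" if y: "y \<in> {p..q}" for y
  proof -
    have y01: "0 \<le> y" "y < 1" using y p0 q1 by auto
    obtain d where d: "\<And>i. d i < m" "expansion (\<lambda>i. real (d i)) (1 / real m) = y"
      using base_expansion_exists[OF m y01] by blast
    obtain t where "t \<in> {b..b'}" "expansion (\<lambda>i. real (d i)) t = x"
      by (rule parameter_exists[where d = d and m = m and x = x and b = b and b' = b' and y = y])
        (use m d x b0 b' y in \<open>auto simp: a_def p_def q_def\<close>)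
    then show ?thesis using d by blast
  qed
  then obtain D g where D: "\<And>y i. y \<in> {p..q} \<Longrightarrow> D y i < m"
    and Dy: "\<And>y. y \<in> {p..q} \<Longrightarrow> expansion (\<lambda>i. real (D y i)) (1 / real m) = y"
    and g: "\<And>y. y \<in> {p..q} \<Longrightarrow> g y \<in> {b..b'}"
    and gx: "\<And>y. y \<in> {p..q} \<Longrightarrow> expansion (\<lambda>i. real (D y i)) (g y) = x"
    by metis
  let ?C = "(4 * (real m - 1) / (b * (1 - real m * b'))) powr s"
  show ?thesis
  proof (rule hausdorff_measure_ne_0_if_holder[of p q ?C s g])
    show "p < q" using b' by (simp add: p_def q_def)
    have "0 < 1 - real m * b'" using b'(3) m by (simp add: a_def field_simps)
    then show "0 < ?C" using b0 m by simp
    show "g y \<in> Lambda m x" if "y \<in> {p..q}" for y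
      using D[OF that] gx[OF that] g[OF that] b0 b' by (auto simp: Lambda_iff[OF m] a_def)
    show "\<bar>y - z\<bar> \<le> ?C * dist (g y) (g z) powr s" if "y \<in> {p..q}" "z \<in> {p..q}" for y z
      using parameter_holder[where d = "D y" and e = "D z", OF m D[OF that(1)] D[OF that(2)] b0 _ s(1) _ g[OF that(1)] g[OF that(2)]
          gx[OF that(1)] gx[OF that(2)]] b b' Dy that by (simp add: a_def)
  qed (use s in simp)
qed

lemma hausdorff_dim_Lambda:
  assumes m: "m \<ge> 2" and x: "0 < x" "x < 1"
  shows "hausdorff_dim (Lambda m x) = 1"
proof (rule antisym)
  have sub: "Lambda m x \<subseteq> {0..1}"
    using le_inverse_base(3)[OF m] by (force simp: Lambda_iff[OF m])
  show "hausdorff_dim (Lambda m x) \<le> 1"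
  proof (rule ennreal_le_epsilon)
    fix \<epsilon> :: real assume \<epsilon>: "0 < \<epsilon>"
    then have "hausdorff_measure (1 + \<epsilon>) (Lambda m x) = 0"
      by (intro hausdorff_measure_unit_interval_eq_0 sub) simp
    then have "hausdorff_dim (Lambda m x) \<le> ennreal (1 + \<epsilon>)"
      unfolding hausdorff_dim_def using \<epsilon> by (intro Inf_lower CollectI exI[of _ "1 + \<epsilon>"]) simp
    then show "hausdorff_dim (Lambda m x) \<le> 1 + ennreal \<epsilon>"
      using \<epsilon> by simp
  qed
  show "1 \<le> hausdorff_dim (Lambda m x)"
    unfolding hausdorff_dim_def
  proof (rule Inf_greatest)
    fix z assume "z \<in> {ennreal s |s. 0 \<le> s \<and> hausdorff_measure s (Lambda m x) = 0}"
    then obtain s where s: "z = ennreal s" "0 \<le> s" "hausdorff_measure s (Lambda m x) = 0" by blast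
    then have "1 \<le> s" using hausdorff_measure_Lambda_ne_0[OF m x] by (meson not_le)
    then show "1 \<le> z" using s ennreal_leI by fastforce
  qed
qed

theorem corollary1p3:
  fixes m :: nat
  assumes "m \<ge> 2"
  shows "\<forall>x\<in>{0<..<1::real}. Lambda m x \<in> null_sets lebesgue \<and> hausdorff_dim (Lambda m x) = 1"
  using null_sets_Lambda[OF assms] hausdorff_dim_Lambda[OF assms] by simp

end
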